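(* Let $n$ be a positive integer and let $A \subseteq \mathbb{Z}$ be any non-empty set. Then $E_A(n) = D_A(n) + n - 1$.
   Context: Let $G = \mathbb{Z}/n\mathbb{Z}$. For a non-empty set $A \subseteq \mathbb{Z}$, the weighted Davenport constant $D_A(n)$ is the least natural number $k$ such that for every sequence $(x_1, \ldots, x_k)$ of elements $x_i \in G$ there exist a non-empty subsequence $(x_{j_1}, \ldots, x_{j_l})$ (with $1 \le j_1 < \cdots < j_l \le k$) and $a_1, \ldots, a_l \in A$ such that $\sum_{i=1}^l a_i x_{j_i} = 0$ in $G$. The constant $E_A(n)$ is the least natural number $t$ such that for every sequence $(x_1, \ldots, x_t)$ of elements $x_i \in G$ there exist indices $1 \le j_1 < \cdots < j_n \le t$ and $\vartheta_1, \ldots, \vartheta_n \in A$ with $\sum_{i=1}^n \vartheta_i x_{j_i} = 0$ in $G$. *)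

theory Defs
  imports "HOL-Number_Theory.Cong"
begin

text \<open>
  The elements of \<open>\<int>/n\<int>\<close> are represented by the integers \<open>0, \<dots>, n - 1\<close>, and equality in
  \<open>\<int>/n\<int>\<close> is congruence modulo \<open>n\<close>. A sequence of length \<open>k\<close> is a function restricted to the
  indices \<open>{1..k}\<close>; its values outside are irrelevant. A choice of indices
  \<open>j\<^sub>1 < \<dots> < j\<^sub>l\<close> in \<open>{1..k}\<close> is given by the set \<open>J = {j\<^sub>1, \<dots>, j\<^sub>l}\<close> of cardinality \<open>l\<close>,
  and the weights are indexed by the elements of \<open>J\<close>.
\<close>

definition zmod_seq :: "nat \<Rightarrow> nat \<Rightarrow> (nat \<Rightarrow> int) \<Rightarrow> bool" where
  "zmod_seq n k x \<longleftrightarrow> (\<forall>i\<in>{1..k}. x i \<in> {0..<int n})"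

definition weighted_zero_sum :: "int set \<Rightarrow> nat \<Rightarrow> (nat \<Rightarrow> int) \<Rightarrow> nat set \<Rightarrow> bool" where
  "weighted_zero_sum A n x J \<longleftrightarrow>
     (\<exists>a. (\<forall>j\<in>J. a j \<in> A) \<and> [(\<Sum>j\<in>J. a j * x j) = 0] (mod int n))"

definition weighted_davenport :: "int set \<Rightarrow> nat \<Rightarrow> nat" where
  "weighted_davenport A n = (LEAST k. \<forall>x. zmod_seq n k x \<longrightarrow>
     (\<exists>J. J \<subseteq> {1..k} \<and> J \<noteq> {} \<and> weighted_zero_sum A n x J))"

definition weighted_egz :: "int set \<Rightarrow> nat \<Rightarrow> nat" where
  "weighted_egz A n = (LEAST t. \<forall>x. zmod_seq n t x \<longrightarrow>
     (\<exists>J. J \<subseteq> {1..t} \<and> card J = n \<and> weighted_zero_sum A n x J))"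

end

theory Submission
  imports Defs
begin

text \<open>
  The lower bound comes from appending \<open>n - 1\<close> zeros to a sequence without weighted zero-sum
  subsequences. For the upper bound let \<open>g\<close> be the gcd of \<open>n\<close> and all differences of weights. A
  term \<open>x\<close> is rigid modulo \<open>h\<close> if \<open>A x\<close> is a single class modulo \<open>h\<close>; for \<open>g dvd h dvd n\<close> the
  rigid classes form a cyclic group of order \<open>g\<close>. Let \<open>h\<close> be the largest such modulus for which
  at most \<open>h - g\<close> terms are not rigid. Translating by a most frequent rigid class \<open>c\<close> costs
  nothing, because a weighted sum of \<open>n\<close> copies of \<open>c\<close> vanishes modulo \<open>h\<close>. A
  maximal subfamily \<open>M\<close> with a weighted zero-sum modulo \<open>h\<close> after the translation omits fewer than
  \<open>min D h\<close> terms, so it has at least \<open>n\<close> terms. By the choice of \<open>h\<close>, it contains a set \<open>J\<close>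
  of fewer than \<open>n div h\<close> rigid terms whose weighted sums fill a whole class modulo \<open>h\<close>. Deleting
  short zero-sums of rigid terms (which exist by Scherk's theorem) and then copies of \<open>c\<close>, always
  outside \<open>J\<close>, brings \<open>M\<close> to exactly \<open>n\<close> terms; adjusting the weights on \<open>J\<close> turns the zero-sum
  modulo \<open>h\<close> into one modulo \<open>n\<close>.
\<close>

section \<open>Periodic sets of integers and Scherk's theorem\<close>


text \<open>Subsets of Z/m are represented by their full preimages in the integers, so that one set
  can be viewed modulo several divisors of \<open>m\<close>. The size of the subset of Z/m is then
  \<open>rcount\<close>.\<close>

definition periodic :: "int \<Rightarrow> int set \<Rightarrow> bool" where
  "periodic m P \<longleftrightarrow> (\<forall>x y. [x = y] (mod m) \<longrightarrow> x \<in> P \<longrightarrow> y \<in> P)"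

definition rcount :: "int \<Rightarrow> int set \<Rightarrow> nat" where
  "rcount m P = card (P \<inter> {0..<m})"

lemma periodicD: "periodic m P \<Longrightarrow> [x = y] (mod m) \<Longrightarrow> x \<in> P \<Longrightarrow> y \<in> P"
  unfolding periodic_def by blast

lemma periodic_mod_iff: "periodic m P \<Longrightarrow> x mod m \<in> P \<longleftrightarrow> x \<in> P"
  using periodicD[of m P x "x mod m"] periodicD[of m P "x mod m" x]
  by (auto simp: cong_def)

lemma periodic_shift: "periodic m P \<Longrightarrow> periodic m ((+) a ` P)"
  unfolding periodic_def
proof (intro allI impI)
  fix x y assume P: "\<forall>x y. [x = y] (mod m) \<longrightarrow> x \<in> P \<longrightarrow> y \<in> P" and "[x = y] (mod m)" "x \<in> (+) a ` P"
  then obtain p where p: "p \<in> P" "x = a + p" by blast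
  have "[p = y - a] (mod m)" using \<open>[x = y] (mod m)\<close> p(2) by (simp add: cong_iff_dvd_diff algebra_simps)
  then have "y - a \<in> P" using P p(1) by blast
  then show "y \<in> (+) a ` P" by (metis diff_add_cancel image_eqI add.commute)
qed

lemma rcount_shift_le:
  assumes "0 < m" "periodic m P"
  shows "rcount m P \<le> rcount m ((+) a ` P)"
  unfolding rcount_def
proof (rule card_inj_on_le[where f = "\<lambda>x. (a + x) mod m"])
  show "inj_on (\<lambda>x. (a + x) mod m) (P \<inter> {0..<m})"
  proof (rule inj_onI)
    fix x y assume xy: "x \<in> P \<inter> {0..<m}" "y \<in> P \<inter> {0..<m}" "(a + x) mod m = (a + y) mod m"
    then have "[a + x = a + y] (mod m)" by (simp add: cong_def)
    then have "[x = y] (mod m)" by (simp add: cong_add_lcancel)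
    then show "x = y" using xy(1,2) by (simp add: cong_def)
  qed
  show "(\<lambda>x. (a + x) mod m) ` (P \<inter> {0..<m}) \<subseteq> (+) a ` P \<inter> {0..<m}"
    using assms periodic_mod_iff[OF periodic_shift[OF assms(2), of a]] by auto
qed simp

lemma rcount_shift:
  assumes "0 < m" "periodic m P"
  shows "rcount m ((+) a ` P) = rcount m P"
proof -
  have "(+) (- a) ` (+) a ` P = P" by (simp add: image_image)
  then show ?thesis
    using rcount_shift_le[OF assms, of a] rcount_shift_le[OF assms(1) periodic_shift[OF assms(2), of a], of "- a"]
    by simp
qed

lemma rcount_mono: "P \<subseteq> Q \<Longrightarrow> rcount m P \<le> rcount m Q"
  unfolding rcount_def by (intro card_mono) auto

lemma rcount_le: "0 < m \<Longrightarrow> int (rcount m P) \<le> m"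
  using card_mono[of "{0..<m}" "P \<inter> {0..<m}"] unfolding rcount_def by auto

lemma rcount_Un_Int: "rcount m (P \<union> Q) + rcount m (P \<inter> Q) = rcount m P + rcount m Q"
  using card_Un_Int[of "P \<inter> {0..<m}" "Q \<inter> {0..<m}"] unfolding rcount_def
  by (simp add: Int_Un_distrib2 Int_ac)

lemma periodic_eqI:
  assumes "0 < m" "periodic m P" "periodic m Q" "P \<subseteq> Q" "rcount m Q \<le> rcount m P"
  shows "P = Q"
proof -
  have "P \<inter> {0..<m} = Q \<inter> {0..<m}"
    using assms(4,5) unfolding rcount_def by (intro card_seteq) auto
  moreover have "x mod m \<in> {0..<m}" for x using assms(1) by simp
  ultimately have "x mod m \<in> P \<longleftrightarrow> x mod m \<in> Q" for x by blast
  then show ?thesis using assms(2,3) by (auto simp: periodic_mod_iff)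
qed

lemma rcount_cong_class:
  assumes "0 < d" "d dvd m" "0 < m"
  shows "int (rcount m {y. [y = s] (mod d)}) = m div d"
proof -
  have md: "d * (m div d) = m" using assms(2) by simp
  have "{y. [y = s] (mod d)} \<inter> {0..<m} = (\<lambda>k. s mod d + d * k) ` {0..<m div d}" (is "?L = ?R")
  proof
    show "?R \<subseteq> ?L"
    proof
      fix y assume "y \<in> ?R"
      then obtain k where k: "0 \<le> k" "k < m div d" "y = s mod d + d * k" by auto
      have "d * (k + 1) \<le> d * (m div d)" using k(2) assms(1) by (intro mult_left_mono) auto
      moreover have "0 \<le> s mod d" "s mod d < d" using assms(1) by auto
      moreover have "0 \<le> d * k" using k(1) assms(1) by simp
      ultimately have "0 \<le> y" "y < m" using k(3) md by (auto simp: algebra_simps)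
      then show "y \<in> ?L" using k(3) by (simp add: cong_def)
    qed
    show "?L \<subseteq> ?R"
    proof
      fix y assume y: "y \<in> ?L"
      then have "y = s mod d + d * (y div d)" by (simp add: cong_def) (metis mod_mult_div_eq)
      moreover have "y div d < m div d"
      proof -
        have "d * (y div d) \<le> y" using mult_div_mod_eq[of d y] pos_mod_sign[OF assms(1), of y] by linarith
        then have "d * (y div d) < d * (m div d)" using y md by simp
        then show ?thesis using assms(1) by simp
      qed
      moreover have "0 \<le> y div d" using y assms(1) by (simp add: pos_imp_zdiv_nonneg_iff)
      ultimately show "y \<in> ?R" by auto
    qed
  qed
  moreover have "inj_on (\<lambda>k. s mod d + d * k) {0..<m div d}"
    using assms(1) by (auto intro: inj_onI)
  ultimately have "rcount m {y. [y = s] (mod d)} = nat (m div d)"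
    unfolding rcount_def by (simp add: card_image)
  then show ?thesis using assms by (simp add: pos_imp_zdiv_nonneg_iff)
qed

lemma rcount_periodic_ge:
  assumes "0 < d" "d dvd m" "0 < m" "periodic d P" "P \<noteq> {}"
  shows "m div d \<le> int (rcount m P)"
proof -
  obtain s where "s \<in> P" using assms(5) by blast
  then have "{y. [y = s] (mod d)} \<subseteq> P" using periodicD[OF assms(4)] cong_sym by blast
  from rcount_mono[OF this, of m] show ?thesis using rcount_cong_class[OF assms(1-3), of s] by simp
qed

text \<open>Induction on the size of \<open>Q\<close>. If \<open>P + Q\<close> leaves
  \<open>P\<close>, a transform passes to a smaller \<open>Q\<close> with the same total size and a
  sumset inside the old one. Otherwise \<open>P\<close> is closed under adding elements of
  \<open>Q\<close>, and the hypothesis leaves only the class 0 in \<open>Q\<close>.\<close>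

lemma scherk:
  assumes "0 < m" "periodic m P" "periodic m Q" "0 \<in> P" "0 \<in> Q"
    and "\<And>p q. p \<in> P \<Longrightarrow> q \<in> Q \<Longrightarrow> m dvd p + q \<Longrightarrow> m dvd p \<and> m dvd q"
  shows "rcount m P + rcount m Q \<le> rcount m {p + q |p q. p \<in> P \<and> q \<in> Q} + 1"
  using assms(2-)
proof (induction "rcount m Q" arbitrary: P Q rule: less_induct)
  case less
  show ?case
  proof (cases "\<exists>p\<in>P. \<exists>q\<in>Q. p + q \<notin> P")
    case True
    then obtain a b where ab: "a \<in> P" "b \<in> Q" "a + b \<notin> P" by blast
    \<comment> \<open>Dyson's transform: it keeps the total size and shrinks \<open>Q\<close>.\<close>
    define P' where "P' = P \<union> (+) a ` Q"
    define Q' where "Q' = {q \<in> Q. a + q \<in> P}"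
    have per: "periodic m P'" "periodic m Q'"
      using less.prems(1,2) periodic_shift[OF less.prems(2), of a] unfolding P'_def Q'_def periodic_def
      by (blast, metis (no_types, lifting) cong_add_lcancel mem_Collect_eq)
    have "P \<inter> (+) a ` Q = (+) a ` Q'" unfolding Q'_def by auto
    then have cnt: "rcount m P' + rcount m Q' = rcount m P + rcount m Q"
      using rcount_Un_Int[of m P "(+) a ` Q"] rcount_shift[OF assms(1) per(2), of a]
        rcount_shift[OF assms(1) less.prems(2), of a] unfolding P'_def by simp
    have "Q' \<noteq> Q" "Q' \<subseteq> Q" using ab unfolding Q'_def by auto
    then have lt: "rcount m Q' < rcount m Q"
      using periodic_eqI[OF assms(1) per(2) less.prems(2)] by force
    \<comment> \<open>For \<open>p = a + c\<close> the hypothesis is applied twice: to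
      \<open>(a + q) + c\<close>, where \<open>a + q\<close> is in \<open>P\<close> by the choice of
      \<open>Q'\<close>, and then to \<open>a + q\<close> itself.\<close>
    have triv: "m dvd p \<and> m dvd q" if pq: "p \<in> P'" "q \<in> Q'" "m dvd p + q" for p q
    proof (cases "p \<in> P")
      case True
      then show ?thesis using less.prems(5)[of p q] pq unfolding Q'_def by blast
    next
      case False
      then obtain c where c: "c \<in> Q" "p = a + c" using pq(1) unfolding P'_def by auto
      have "m dvd (a + q) \<and> m dvd c"
        using less.prems(5)[of "a + q" c] pq c unfolding Q'_def by (simp add: add_ac)
      moreover from this have "m dvd a \<and> m dvd q"
        using less.prems(5)[of a q] ab(1) pq(2) unfolding Q'_def by blast
      ultimately show ?thesis using c(2) by simp
    qed
    have "rcount m P' + rcount m Q' \<le> rcount m {p + q |p q. p \<in> P' \<and> q \<in> Q'} + 1"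
      using less.prems(3,4) ab(1) triv by (intro less.hyps[OF lt per]) (auto simp: P'_def Q'_def)
    moreover have "rcount m {p + q |p q. p \<in> P' \<and> q \<in> Q'} \<le> rcount m {p + q |p q. p \<in> P \<and> q \<in> Q}"
    proof (rule rcount_mono, clarify)
      fix p q assume pq: "p \<in> P'" "q \<in> Q'"
      show "\<exists>p' q'. p + q = p' + q' \<and> p' \<in> P \<and> q' \<in> Q"
      proof (cases "p \<in> P")
        case True
        then show ?thesis using pq unfolding Q'_def by blast
      next
        case False
        then obtain c where c: "c \<in> Q" "p = a + c" using pq(1) unfolding P'_def by auto
        then have "p + q = (a + q) + c" "a + q \<in> P" using pq(2) unfolding Q'_def by auto
        then show ?thesis using c(1) by blast
      qed
    qed
    ultimately show ?thesis using cnt by linarith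
  next
    case False
    \<comment> \<open>Starting from 0, adding \<open>q\<close> repeatedly stays in \<open>P\<close>.
      So \<open>P\<close> contains \<open>(m - 1) * q\<close>, which is congruent to
      \<open>- q\<close> and cancels \<open>q\<close>.\<close>
    have "m dvd q" if q: "q \<in> Q" for q
    proof -
      have *: "int k * q \<in> P" for k
      proof (induction k)
        case (Suc k)
        then have "int k * q + q \<in> P" using False q by blast
        then show ?case by (simp add: algebra_simps)
      qed (simp add: less.prems(3))
      have "(m - 1) * q \<in> P" using *[of "nat (m - 1)"] assms(1) by simp
      moreover have "m dvd (m - 1) * q + q" by (simp add: algebra_simps)
      ultimately show ?thesis using less.prems(5) q by blast
    qed
    then have "Q \<inter> {0..<m} \<subseteq> {0}" using zdvd_imp_le[of m] by fastforce
    then have "rcount m Q \<le> 1" unfolding rcount_def using card_mono[of "{0::int}"] by force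
    moreover have "rcount m P \<le> rcount m {p + q |p q. p \<in> P \<and> q \<in> Q}"
      using less.prems(4) by (intro rcount_mono) force
    ultimately show ?thesis by simp
  qed
qed

text \<open>Turns the stabilizer of a periodic set into a single modulus \<open>d\<close>: the least
  positive element divides all others by division with remainder.\<close>

lemma int_subgroup_principal:
  fixes S :: "int set"
  assumes diff: "\<And>x y. x \<in> S \<Longrightarrow> y \<in> S \<Longrightarrow> x - y \<in> S" and m: "m \<in> S" "0 < m"
  obtains d where "0 < d" "\<And>z. z \<in> S \<longleftrightarrow> d dvd z"
proof -
  have zero: "0 \<in> S" using diff[OF m(1) m(1)] by simp
  have add: "x + y \<in> S" if "x \<in> S" "y \<in> S" for x y
    using diff[OF that(1) diff[OF zero that(2)]] by simp
  have mul: "x * k \<in> S" if "x \<in> S" for x k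
  proof (induction k rule: int_induct[where k = 0])
    case (step1 i) then show ?case using add[of "x * i" x] that by (simp add: algebra_simps)
  next
    case (step2 i) then show ?case using diff[of "x * i" x] that by (simp add: algebra_simps)
  qed (simp add: zero)
  obtain k where k: "0 < k \<and> k \<in> S" and least: "\<And>j. 0 < j \<and> j \<in> S \<Longrightarrow> nat k \<le> nat j"
    using ex_has_least_nat[of "\<lambda>k. 0 < k \<and> k \<in> S" m nat] m by blast
  have "k dvd z" if "z \<in> S" for z
  proof -
    have "z mod k \<in> S" using diff[OF that mul[of k "z div k"]] k by (simp add: minus_mult_div_eq_mod)
    then have "\<not> 0 < z mod k" using least[of "z mod k"] k pos_mod_bound[of k z] by linarith
    then show ?thesis using k pos_mod_sign[of k z] unfolding dvd_eq_mod_eq_0 by linarith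
  qed
  moreover have "z \<in> S" if "k dvd z" for z using that mul k by (auto elim!: dvdE)
  ultimately show ?thesis using that k by blast
qed

section \<open>Short zero-sum subsequences\<close>


text \<open>The sum on the left is the size of the first \<open>k\<close> layers of
  \<open>W\<close>, each layer taking one term from every residue class still present. By Scherk's
  theorem each layer increases the number of short sums by at least its size; the absence of short
  zero-sums supplies the hypothesis of that theorem.\<close>

lemma short_zero_sum_step:
  fixes v :: "'i \<Rightarrow> int" and k :: nat
  assumes "0 < g" "finite W" "\<And>i. i \<in> W \<Longrightarrow> \<not> g dvd v i"
    and "\<And>R. R \<subseteq> W \<Longrightarrow> R \<noteq> {} \<Longrightarrow> card R \<le> k \<Longrightarrow> \<not> g dvd (\<Sum>i\<in>R. v i)"
  shows "(\<Sum>u\<in>{1..<g}. min k (card {i\<in>W. v i mod g = u})) + 1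
    \<le> rcount g {y. \<exists>R\<subseteq>W. card R \<le> k \<and> [y = (\<Sum>i\<in>R. v i)] (mod g)}"
  using assms(2-)
proof (induction k arbitrary: W)
  case 0
  have "{y::int. [y = 0] (mod g)} \<subseteq> {y. \<exists>R\<subseteq>W. card R \<le> 0 \<and> [y = (\<Sum>i\<in>R. v i)] (mod g)}"
    by (auto intro!: exI[of _ "{}"])
  from rcount_mono[OF this, of g] show ?case
    using rcount_cong_class[of g g 0] assms(1) by simp
next
  case (Suc k)
  note fin = Suc.prems(1)
  define cls where "cls i = v i mod g" for i
  \<comment> \<open>Split off one element of each residue class and add its contribution by Scherk's theorem.\<close>
  obtain W1 where W1: "W1 \<subseteq> W" "inj_on cls W1" "cls ` W1 = cls ` W"
    using subset_image_inj[THEN iffD1, OF subset_refl[of "cls ` W"]] by metis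
  define W' where "W' = W - W1"
  define S where "S k W = {y. \<exists>R\<subseteq>W. card R \<le> k \<and> [y = (\<Sum>i\<in>R. v i)] (mod g)}" for k W
  define B where "B = {y. \<exists>R\<subseteq>W1. card R \<le> 1 \<and> [y = (\<Sum>i\<in>R. v i)] (mod g)}"
  have fin1: "finite W1" using W1(1) fin finite_subset by blast
  have per: "periodic g (S k W')" "periodic g B"
    unfolding periodic_def S_def B_def using cong_sym cong_trans mem_Collect_eq by (smt (verit))+
  have disj: "R1 \<inter> R2 = {}" if "R1 \<subseteq> W'" "R2 \<subseteq> W1" for R1 R2 using that unfolding W'_def by blast
  have union: "R1 \<union> R2 \<subseteq> W \<and> card (R1 \<union> R2) \<le> Suc k \<and>
      (\<Sum>i\<in>R1 \<union> R2. v i) = (\<Sum>i\<in>R1. v i) + (\<Sum>i\<in>R2. v i)"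
    if "R1 \<subseteq> W'" "R2 \<subseteq> W1" "card R1 \<le> k" "card R2 \<le> 1" for R1 R2
  proof -
    have "finite R1" "finite R2" using that fin W1(1) finite_subset[of _ W] unfolding W'_def by blast+
    then show ?thesis using disj[OF that(1,2)] that W1(1) unfolding W'_def
      by (auto simp: sum.union_disjoint card_Un_disjoint)
  qed
  have "rcount g B = card W1 + 1"
  proof -
    have "B \<inter> {0..<g} = insert 0 (cls ` W1)"
    proof
      show "B \<inter> {0..<g} \<subseteq> insert 0 (cls ` W1)"
      proof
        fix y assume y: "y \<in> B \<inter> {0..<g}"
        then obtain R where R: "R \<subseteq> W1" "card R \<le> 1" "[y = (\<Sum>i\<in>R. v i)] (mod g)" unfolding B_def by blast
        have "y = y mod g" using y by simp
        also have "\<dots> = (\<Sum>i\<in>R. v i) mod g" using R(3) by (simp add: cong_def)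
        finally have "y = (\<Sum>i\<in>R. v i) mod g" .
        moreover have "R = {} \<or> (\<exists>i. R = {i})"
          using R(1,2) fin1 finite_subset[of R W1] by (metis card_1_singletonE card_0_eq le_Suc_eq One_nat_def le_zero_eq)
        ultimately show "y \<in> insert 0 (cls ` W1)" using R(1) unfolding cls_def by auto
      qed
      have "0 \<in> B" unfolding B_def by (auto intro!: exI[of _ "{}"])
      moreover have "cls i \<in> B" if "i \<in> W1" for i
        unfolding B_def cls_def using that by (auto intro!: exI[of _ "{i}"] simp: cong_def)
      moreover have "cls i \<in> {0..<g}" for i unfolding cls_def using assms(1) by simp
      ultimately show "insert 0 (cls ` W1) \<subseteq> B \<inter> {0..<g}" using assms(1) by auto
    qed
    moreover have "0 \<notin> cls ` W1" using Suc.prems(2) W1(1) unfolding cls_def by (auto simp: dvd_eq_mod_eq_0)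
    ultimately show ?thesis unfolding rcount_def using W1(2) fin1 by (simp add: card_image)
  qed
  moreover have "(\<Sum>u\<in>{1..<g}. min k (card {i\<in>W'. v i mod g = u})) + 1 \<le> rcount g (S k W')"
    unfolding S_def
  proof (rule Suc.IH)
    show "finite W'" using fin unfolding W'_def by simp
  next
    fix R assume R: "R \<subseteq> W'" "R \<noteq> {}" "card R \<le> k"
    then show "\<not> g dvd (\<Sum>i\<in>R. v i)" using Suc.prems(3)[of R] unfolding W'_def by auto
  qed (use Suc.prems(2) in \<open>auto simp: W'_def\<close>)
  moreover have "rcount g (S k W') + rcount g B \<le> rcount g {p + q |p q. p \<in> S k W' \<and> q \<in> B} + 1"
  proof (rule scherk[OF assms(1) per])
    show "0 \<in> S k W'" "0 \<in> B" unfolding B_def S_def by (auto intro!: exI[of _ "{}"])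
  next
    fix p q assume pq: "p \<in> S k W'" "q \<in> B" "g dvd p + q"
    obtain R1 where R1: "R1 \<subseteq> W'" "card R1 \<le> k" "[p = (\<Sum>i\<in>R1. v i)] (mod g)"
      using pq(1) unfolding S_def by blast
    obtain R2 where R2: "R2 \<subseteq> W1" "card R2 \<le> 1" "[q = (\<Sum>i\<in>R2. v i)] (mod g)"
      using pq(2) unfolding B_def by blast
    \<comment> \<open>A vanishing \<open>p + q\<close> would come from a zero-sum with at most
      \<open>Suc k\<close> terms, so both index sets must be empty.\<close>
    have "[p + q = (\<Sum>i\<in>R1 \<union> R2. v i)] (mod g)"
      using cong_add[OF R1(3) R2(3)] union[OF R1(1) R2(1) R1(2) R2(2)] by simp
    then have "g dvd (\<Sum>i\<in>R1 \<union> R2. v i)" using pq(3) cong_dvd_iff by blast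
    then have "R1 = {} \<and> R2 = {}"
      using Suc.prems(3)[of "R1 \<union> R2"] union[OF R1(1) R2(1) R1(2) R2(2)] by auto
    then show "g dvd p \<and> g dvd q" using R1(3) R2(3) by (simp add: cong_0_iff)
  qed
  moreover have "rcount g {p + q |p q. p \<in> S k W' \<and> q \<in> B} \<le> rcount g (S (Suc k) W)"
  proof (rule rcount_mono, clarify)
    fix p q assume pq: "p \<in> S k W'" "q \<in> B"
    obtain R1 where R1: "R1 \<subseteq> W'" "card R1 \<le> k" "[p = (\<Sum>i\<in>R1. v i)] (mod g)"
      using pq(1) unfolding S_def by blast
    obtain R2 where R2: "R2 \<subseteq> W1" "card R2 \<le> 1" "[q = (\<Sum>i\<in>R2. v i)] (mod g)"
      using pq(2) unfolding B_def by blast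
    have "[p + q = (\<Sum>i\<in>R1 \<union> R2. v i)] (mod g)"
      using cong_add[OF R1(3) R2(3)] union[OF R1(1) R2(1) R1(2) R2(2)] by simp
    then show "p + q \<in> S (Suc k) W" unfolding S_def using union[OF R1(1) R2(1) R1(2) R2(2)] by blast
  qed
  moreover have "(\<Sum>u\<in>{1..<g}. min (Suc k) (card {i\<in>W. v i mod g = u}))
      = (\<Sum>u\<in>{1..<g}. min k (card {i\<in>W'. v i mod g = u})) + card W1"
  proof -
    \<comment> \<open>Every class that occurs in \<open>W\<close> loses exactly one term to
      \<open>W1\<close>, so the truncation drops from \<open>Suc k\<close> to
      \<open>k\<close>.\<close>
    have "min (Suc k) (card {i\<in>W. v i mod g = u})
        = min k (card {i\<in>W'. v i mod g = u}) + card {i\<in>W1. v i mod g = u}" for u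
    proof -
      have split: "{i\<in>W. v i mod g = u} = {i\<in>W'. v i mod g = u} \<union> {i\<in>W1. v i mod g = u}"
        using W1(1) unfolding W'_def by blast
      have card: "card {i\<in>W. v i mod g = u} = card {i\<in>W'. v i mod g = u} + card {i\<in>W1. v i mod g = u}"
        unfolding split using fin fin1 by (intro card_Un_disjoint) (auto simp: W'_def)
      show ?thesis
      proof (cases "u \<in> cls ` W")
        case True
        then obtain i where i: "i \<in> W1" "cls i = u" using W1(3) by (metis imageE)
        then have "{i\<in>W1. v i mod g = u} = {i}" using W1(2) unfolding cls_def by (auto dest: inj_onD)
        then show ?thesis using card by simp
      next
        case False
        then have *: "{i\<in>W. v i mod g = u} = {}" unfolding cls_def by auto
        then have "{i\<in>W'. v i mod g = u} = {}" "{i\<in>W1. v i mod g = u} = {}"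
          using split by blast+
        then show ?thesis by (simp only: * card.empty)
      qed
    qed
    moreover have "card W1 = (\<Sum>u\<in>{1..<g}. card {i\<in>W1. v i mod g = u})"
    proof -
      have "v i mod g \<in> {1..<g}" if "i \<in> W1" for i
        using Suc.prems(2)[of i] that W1(1) pos_mod_bound[OF assms(1), of "v i"] pos_mod_sign[OF assms(1), of "v i"]
        by (auto simp: dvd_eq_mod_eq_0)
      then have "W1 = (\<Union>u\<in>{1..<g}. {i\<in>W1. v i mod g = u})" by auto
      then show ?thesis using fin1 card_UN_disjoint[of "{1..<g}" "\<lambda>u. {i\<in>W1. v i mod g = u}"] by auto
    qed
    ultimately show ?thesis by (simp add: sum.distrib)
  qed
  ultimately show ?case unfolding S_def by linarith
qed

text \<open>Otherwise the preceding bound would produce at least \<open>g + 1\<close> classes modulo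
  \<open>g\<close>.\<close>

lemma short_zero_sum:
  fixes v :: "'i \<Rightarrow> int" and k :: nat
  assumes "0 < g" "finite W" "\<And>i. i \<in> W \<Longrightarrow> \<not> g dvd v i"
    and "g \<le> int (\<Sum>u\<in>{1..<g}. min k (card {i\<in>W. v i mod g = u}))"
  obtains R where "R \<subseteq> W" "R \<noteq> {}" "card R \<le> k" "g dvd (\<Sum>i\<in>R. v i)"
proof (rule ccontr)
  assume "\<not> thesis"
  then have "(\<Sum>u\<in>{1..<g}. min k (card {i\<in>W. v i mod g = u})) + 1
      \<le> rcount g {y. \<exists>R\<subseteq>W. card R \<le> k \<and> [y = (\<Sum>i\<in>R. v i)] (mod g)}"
    using that assms(3) by (intro short_zero_sum_step[OF assms(1,2)]) blast+
  then show False
    using assms(4) rcount_le[OF assms(1), of "{y. \<exists>R\<subseteq>W. card R \<le> k \<and> [y = (\<Sum>i\<in>R. v i)] (mod g)}"]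
    by linarith
qed

section \<open>Weighted sums filling a residue class\<close>


text \<open>The sumset of the sets \<open>A * x j\<close> in Z/m, as a periodic set of integers.
  Every term of \<open>J\<close> is used, each with its own weight.\<close>

definition reach :: "int set \<Rightarrow> int \<Rightarrow> ('i \<Rightarrow> int) \<Rightarrow> 'i set \<Rightarrow> int set" where
  "reach A m x J = {y. \<exists>a. (\<forall>j\<in>J. a j \<in> A) \<and> [(\<Sum>j\<in>J. a j * x j) = y] (mod m)}"

definition rigid :: "int set \<Rightarrow> int \<Rightarrow> int \<Rightarrow> bool" where
  "rigid A h x \<longleftrightarrow> (\<forall>a\<in>A. \<forall>b\<in>A. [a * x = b * x] (mod h))"

lemma reachI: "(\<And>j. j \<in> J \<Longrightarrow> a j \<in> A) \<Longrightarrow> [(\<Sum>j\<in>J. a j * x j) = y] (mod m) \<Longrightarrow> y \<in> reach A m x J"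
  unfolding reach_def by blast

lemma periodic_reach: "periodic m (reach A m x J)"
  unfolding periodic_def reach_def by (blast intro: cong_trans)

lemma reach_empty: "reach A m x {} = {y. [y = 0] (mod m)}"
  unfolding reach_def by (auto simp: cong_sym_eq)

lemma reach_nonempty: "A \<noteq> {} \<Longrightarrow> reach A m x J \<noteq> {}"
proof -
  assume "A \<noteq> {}"
  then obtain a where "a \<in> A" by blast
  then have "(\<Sum>j\<in>J. a * x j) \<in> reach A m x J" by (intro reachI[where a = "\<lambda>_. a"]) auto
  then show ?thesis by blast
qed

lemma reach_Un:
  assumes "finite J" "finite K" "J \<inter> K = {}" "y \<in> reach A m x J" "z \<in> reach A m x K"
  shows "y + z \<in> reach A m x (J \<union> K)"
proof -
  obtain a where a: "\<forall>j\<in>J. a j \<in> A" "[(\<Sum>j\<in>J. a j * x j) = y] (mod m)"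
    using assms(4) unfolding reach_def by blast
  obtain b where b: "\<forall>j\<in>K. b j \<in> A" "[(\<Sum>j\<in>K. b j * x j) = z] (mod m)"
    using assms(5) unfolding reach_def by blast
  define c where "c j = (if j \<in> J then a j else b j)" for j
  have "(\<Sum>j\<in>J. c j * x j) = (\<Sum>j\<in>J. a j * x j)" unfolding c_def by (intro sum.cong) auto
  moreover have "(\<Sum>j\<in>K. c j * x j) = (\<Sum>j\<in>K. b j * x j)"
    unfolding c_def using assms(3) by (intro sum.cong) auto
  ultimately have "(\<Sum>j\<in>J \<union> K. c j * x j) = (\<Sum>j\<in>J. a j * x j) + (\<Sum>j\<in>K. b j * x j)"
    using assms(1-3) by (simp add: sum.union_disjoint)
  then show ?thesis
    using a b cong_add[OF a(2) b(2)] by (intro reachI[where a = c]) (auto simp: c_def)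
qed

lemma reach_dvd:
  assumes "k dvd m" "y \<in> reach A m x J" shows "y \<in> reach A k x J"
  using assms unfolding reach_def by (auto intro: cong_dvd_modulus)

lemma rigid_dvd: "rigid A m x \<Longrightarrow> k dvd m \<Longrightarrow> rigid A k x"
  unfolding rigid_def by (blast intro: cong_dvd_modulus)

text \<open>Changing the weight of a rigid term does not change its contribution, so all weighted
  sums lie in one class.\<close>

lemma rigid_reach_cong:
  assumes "\<And>j. j \<in> J \<Longrightarrow> rigid A m (x j)" "y \<in> reach A m x J" "z \<in> reach A m x J"
  shows "[y = z] (mod m)"
proof -
  obtain a where a: "\<forall>j\<in>J. a j \<in> A" "[(\<Sum>j\<in>J. a j * x j) = y] (mod m)"
    using assms(2) unfolding reach_def by blast
  obtain b where b: "\<forall>j\<in>J. b j \<in> A" "[(\<Sum>j\<in>J. b j * x j) = z] (mod m)"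
    using assms(3) unfolding reach_def by blast
  have "[(\<Sum>j\<in>J. a j * x j) = (\<Sum>j\<in>J. b j * x j)] (mod m)"
    using assms(1) a(1) b(1) unfolding rigid_def by (intro cong_sum) blast
  then show ?thesis using a(2) b(2) by (meson cong_sym cong_trans)
qed

text \<open>\<open>J\<close> is a largest subfamily with more weighted sums than terms, and
  \<open>d\<close> generates the stabilizer of its set of sums. A further term cannot enlarge this
  set, so the differences of its weighted values lie in the stabilizer.\<close>

lemma greedy_stabilizer:
  fixes x :: "'i \<Rightarrow> int"
  assumes "A \<noteq> {}" "finite U" "0 < m"
  obtains J d where "J \<subseteq> U" "card J < rcount m (reach A m x J)" "0 < d" "d dvd m"
    "periodic d (reach A m x J)" "\<And>i. i \<in> U - J \<Longrightarrow> rigid A d (x i)"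
proof -
  define good where "good J \<longleftrightarrow> J \<subseteq> U \<and> card J < rcount m (reach A m x J)" for J
  have "good {}"
    \<comment> \<open>The empty family has no terms but one sum, the class 0.\<close>
    unfolding good_def reach_empty using rcount_cong_class[of m m 0] assms(3) by simp
  moreover have "\<forall>J. good J \<longrightarrow> card J < card U + 1"
    unfolding good_def using assms(2) by (auto simp: card_mono le_imp_less_Suc)
  ultimately obtain J where J: "good J" and J_max: "\<And>K. good K \<Longrightarrow> card K \<le> card J"
    using ex_has_greatest_nat[of good "{}" card "card U + 1"] by blast
  define X where "X = reach A m x J"
  have finJ: "finite J" using J assms(2) finite_subset unfolding good_def by blast
  have perX: "periodic m X" unfolding X_def by (rule periodic_reach)
  \<comment> \<open>The stabilizer of \<open>X\<close> under translation. It is a subgroup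
    containing \<open>m\<close>, hence consists of the multiples of some divisor \<open>d\<close> of
    \<open>m\<close>.\<close>
  define S where "S = {z. \<forall>y. y \<in> X \<longleftrightarrow> y + z \<in> X}"
  have S_diff: "z - w \<in> S" if "z \<in> S" "w \<in> S" for z w
  proof -
    have "y \<in> X \<longleftrightarrow> y + (z - w) \<in> X" for y
    proof -
      have "y \<in> X \<longleftrightarrow> y + z \<in> X" using that(1) unfolding S_def by blast
      moreover have "y + (z - w) \<in> X \<longleftrightarrow> y + (z - w) + w \<in> X" using that(2) unfolding S_def by blast
      ultimately show ?thesis by simp
    qed
    then show ?thesis unfolding S_def by blast
  qed
  have "y \<in> X \<longleftrightarrow> y + m \<in> X" for y
    using periodicD[OF perX, of y "y + m"] periodicD[OF perX, of "y + m" y]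
    by (auto simp: cong_iff_dvd_diff)
  then have "m \<in> S" unfolding S_def by blast
  then obtain d where d: "0 < d" "\<And>z. z \<in> S \<longleftrightarrow> d dvd z"
    using int_subgroup_principal[of S m] S_diff assms(3) by blast
  have "rigid A d (x i)" if i: "i \<in> U - J" for i
  proof -
    let ?Y = "reach A m x (insert i J)"
    \<comment> \<open>By maximality adding \<open>i\<close> does not enlarge the set of sums, so all its translates by
      \<open>a * x i\<close> agree.\<close>
    have "\<not> good (insert i J)" using J_max[of "insert i J"] i finJ by auto
    then have le: "rcount m ?Y \<le> rcount m X"
      using J i finJ unfolding good_def X_def by auto
    have shift: "(+) (a * x i) ` X = ?Y" if "a \<in> A" for a
    proof (rule periodic_eqI[OF assms(3) periodic_shift[OF perX] periodic_reach])
      have "a * x i \<in> reach A m x {i}" using that by (intro reachI[where a = "\<lambda>_. a"]) auto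
      then show "(+) (a * x i) ` X \<subseteq> ?Y"
        using reach_Un[of "{i}" J "a * x i" A m x] finJ i unfolding X_def by auto
      show "rcount m ?Y \<le> rcount m ((+) (a * x i) ` X)"
        using le rcount_shift[OF assms(3) perX] by simp
    qed
    have "a * x i - b * x i \<in> S" if "a \<in> A" "b \<in> A" for a b
    proof -
      have "(y \<in> X) = (y + (a * x i - b * x i) \<in> X)" for y
      proof -
        have mem: "c + z \<in> (+) c ` X \<longleftrightarrow> z \<in> X" for c z :: int by auto
        have "y \<in> X \<longleftrightarrow> a * x i + y \<in> ?Y" using mem shift[OF that(1)] by blast
        also have "a * x i + y = b * x i + (y + (a * x i - b * x i))" by simp
        also have "\<dots> \<in> ?Y \<longleftrightarrow> y + (a * x i - b * x i) \<in> X" using mem shift[OF that(2)] by blast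
        finally show ?thesis .
      qed
      then show ?thesis unfolding S_def by blast
    qed
    then show ?thesis unfolding rigid_def using d(2) by (simp add: cong_iff_dvd_diff)
  qed
  moreover have "periodic d X"
    unfolding periodic_def
  proof (intro allI impI)
    fix y z assume "[y = z] (mod d)" "y \<in> X"
    then have "z - y \<in> S" using d(2) by (simp add: cong_iff_dvd_diff dvd_diff_commute)
    then have "y + (z - y) \<in> X" using \<open>y \<in> X\<close> unfolding S_def by blast
    then show "z \<in> X" by simp
  qed
  moreover have "d dvd m" using d(2) \<open>m \<in> S\<close> by blast
  ultimately show ?thesis using that[of J d] J d(1) unfolding good_def X_def by blast
qed

text \<open>The sums of a greedy \<open>J\<close> form a set with period \<open>e\<close> inside one
  class modulo \<open>d\<close>. If they missed part of it, they would miss at least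
  \<open>m div e\<close> classes modulo \<open>m\<close>; since all terms outside \<open>J\<close>
  are rigid modulo \<open>e\<close>, \<open>small\<close> would then make \<open>U\<close> smaller
  than \<open>m div d\<close>.\<close>

lemma rigid_coset:
  fixes x :: "'i \<Rightarrow> int"
  assumes "A \<noteq> {}" "finite U" "0 < d" "d dvd m" "d < m"
    and rigid_d: "\<And>i. i \<in> U \<Longrightarrow> rigid A d (x i)"
    and large: "m div d \<le> int (card U)"
    and small: "\<And>e. 0 < e \<Longrightarrow> d dvd e \<Longrightarrow> e dvd m \<Longrightarrow> d < e \<Longrightarrow> int (card {i\<in>U. rigid A e (x i)}) < m div e"
  obtains J s where "J \<subseteq> U" "int (card J) < m div d" "{y. [y = s] (mod d)} \<subseteq> reach A m x J"
proof -
  have m: "0 < m" using assms(3,5) by simp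
  obtain J e where J: "J \<subseteq> U" "card J < rcount m (reach A m x J)" "0 < e" "e dvd m"
    "periodic e (reach A m x J)" "\<And>i. i \<in> U - J \<Longrightarrow> rigid A e (x i)"
    using greedy_stabilizer[OF assms(1,2) m] by metis
  define X where "X = reach A m x J"
  obtain s where s: "s \<in> X" using reach_nonempty[OF assms(1)] unfolding X_def by blast
  have X_sub: "X \<subseteq> {y. [y = s] (mod d)}"
    using rigid_reach_cong[of J A d x] reach_dvd[OF assms(4)] rigid_d J(1) s unfolding X_def by blast
  \<comment> \<open>Both \<open>s\<close> and \<open>s + e\<close> lie in \<open>X\<close>, which is
    inside one class modulo \<open>d\<close>; hence \<open>d dvd e\<close>.\<close>
  have "s + e \<in> X" using periodicD[of e X s "s + e"] J(5) s unfolding X_def by (simp add: cong_def)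
  then have de: "d dvd e" using X_sub by (auto simp: cong_iff_dvd_diff)
  have "X = {y. [y = s] (mod d)}"
  proof (rule ccontr)
    assume ne: "X \<noteq> {y. [y = s] (mod d)}"
    have "e \<noteq> d"
    proof
      assume "e = d"
      then have "{y. [y = s] (mod d)} \<subseteq> X"
        using periodicD[of e X s] J(5) s unfolding X_def by (auto intro: cong_sym)
      then show False using ne X_sub by blast
    qed
    then have "d < e" using zdvd_imp_le[OF de J(3)] by simp
    define C where "C = {y. [y = s] (mod d)} - X"
    have "periodic e C"
      unfolding periodic_def
    proof (intro allI impI)
      fix y z assume yz: "[y = z] (mod e)" "y \<in> C"
      have "[z = s] (mod d)"
        using yz cong_dvd_modulus[OF yz(1) de] unfolding C_def by (blast intro: cong_trans cong_sym)
      moreover have "z \<notin> X"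
        using periodicD[OF J(5) cong_sym[OF yz(1)]] yz(2) unfolding C_def X_def by blast
      ultimately show "z \<in> C" unfolding C_def by blast
    qed
    then have "m div e \<le> int (rcount m C)"
      using ne X_sub by (intro rcount_periodic_ge[OF J(3,4) m]) (auto simp: C_def)
    moreover have "int (rcount m C) + int (rcount m X) = m div d"
    proof -
      have "X \<union> C = {y. [y = s] (mod d)}" "X \<inter> C = {}" using X_sub unfolding C_def by auto
      then show ?thesis
        using rcount_Un_Int[of m X C] rcount_cong_class[OF assms(3,4) m, of s]
        by (simp add: rcount_def)
    qed
    moreover have "int (card U) \<le> int (card J) + int (card {i\<in>U. rigid A e (x i)})"
    proof -
      have "U \<subseteq> J \<union> {i\<in>U. rigid A e (x i)}" using J(6) by blast
      moreover have "finite (J \<union> {i\<in>U. rigid A e (x i)})" using J(1) assms(2) finite_subset by auto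
      ultimately have "card U \<le> card J + card {i\<in>U. rigid A e (x i)}"
        using card_mono card_Un_le order_trans by meson
      then show ?thesis by linarith
    qed
    ultimately show False using small[OF J(3) de J(4) \<open>d < e\<close>] large J(2) unfolding X_def by linarith
  qed
  moreover have "int (rcount m X) = m div d"
    using rcount_cong_class[OF assms(3,4) m, of s] calculation by simp
  ultimately show ?thesis using that[of J s] J(1,2) unfolding X_def by auto
qed

text \<open>Descent on \<open>k\<close>, starting from \<open>n\<close> with \<open>J\<close> empty.
  If too many terms are not rigid modulo \<open>k\<close>, some of them fill a class modulo a
  smaller \<open>d\<close>, up to multiples of \<open>k\<close>; the old \<open>J\<close> corrects
  these multiples.\<close>

lemma rigid_core:
  fixes x :: "'i \<Rightarrow> int"
  assumes "A \<noteq> {}" "finite V" "0 < n" "0 < h" "h dvd n" "\<And>i. i \<in> V \<Longrightarrow> rigid A h (x i)"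
  obtains k J s where "0 < k" "h dvd k" "k dvd n" "J \<subseteq> V" "int (card J) < n div k"
    "{y. [y = s] (mod k)} \<subseteq> reach A n x J"
    "int (card {i\<in>V. \<not> rigid A k (x i)}) < k div h"
proof -
  \<comment> \<open>Rigidity modulo \<open>k\<close> of the terms of \<open>J\<close> keeps them
    disjoint from the new terms, which are chosen not rigid modulo \<open>k\<close>.\<close>
  define Q where "Q k \<longleftrightarrow> 0 < k \<and> h dvd k \<and> k dvd n \<and> (\<exists>J\<subseteq>V. \<exists>s. int (card J) < n div k \<and>
      (\<forall>j\<in>J. rigid A k (x j)) \<and> {y. [y = s] (mod k)} \<subseteq> reach A n x J)" for k
  have "Q n"
    unfolding Q_def using assms(3,5) by (auto intro!: exI[of _ "{}"] exI[of _ 0] simp: reach_empty)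
  then obtain k where k: "Q k" and k_min: "\<And>l. Q l \<Longrightarrow> nat k \<le> nat l"
    using ex_has_least_nat[of Q n nat] by blast
  obtain J s where J: "J \<subseteq> V" "int (card J) < n div k" "\<forall>j\<in>J. rigid A k (x j)"
      "{y. [y = s] (mod k)} \<subseteq> reach A n x J" and k': "0 < k" "h dvd k" "k dvd n"
    using k unfolding Q_def by blast
  have "int (card {i\<in>V. \<not> rigid A k (x i)}) < k div h"
  proof (rule ccontr)
    assume many: "\<not> int (card {i\<in>V. \<not> rigid A k (x i)}) < k div h"
    define U where "U d = {i\<in>V. rigid A d (x i) \<and> \<not> rigid A k (x i)}" for d
    define T where "T d \<longleftrightarrow> 0 < d \<and> h dvd d \<and> d dvd k \<and> d < k \<and> k div d \<le> int (card (U d))" for d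
    have "h \<noteq> k"
    proof
      assume "h = k"
      then have "{i\<in>V. \<not> rigid A k (x i)} = {}" using assms(6) by blast
      then have "card {i\<in>V. \<not> rigid A k (x i)} = 0" by (simp only: card.empty)
      then show False using many \<open>h = k\<close> k'(1) by simp
    qed
    moreover have "U h = {i\<in>V. \<not> rigid A k (x i)}" unfolding U_def using assms(6) by blast
    ultimately have "T h"
      unfolding T_def using many assms(4) k' zdvd_imp_le[OF k'(2,1)] by simp
    moreover have "\<forall>d. T d \<longrightarrow> nat d < nat k" unfolding T_def by auto
    \<comment> \<open>The largest such \<open>d\<close> is taken because its maximality is exactly
      the smallness condition of \<open>rigid_coset\<close> for the moduli \<open>e\<close> between
      \<open>d\<close> and \<open>k\<close>. For \<open>e = k\<close> the family is empty by the
      definition of \<open>U\<close>.\<close>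
    ultimately obtain d where d: "T d" and d_max: "\<And>e. T e \<Longrightarrow> nat e \<le> nat d"
      using ex_has_greatest_nat[of T h nat "nat k"] by blast
    have d': "0 < d" "h dvd d" "d dvd k" "d < k" "k div d \<le> int (card (U d))" using d unfolding T_def by auto
    have finU: "finite (U d)" unfolding U_def using assms(2) by simp
    obtain J' s' where J': "J' \<subseteq> U d" "int (card J') < k div d"
      "{y. [y = s'] (mod d)} \<subseteq> reach A k x J'"
    proof (rule rigid_coset[OF assms(1) finU d'(1,3,4) _ d'(5)])
      fix i assume "i \<in> U d" then show "rigid A d (x i)" unfolding U_def by blast
    next
      fix e assume e: "0 < e" "d dvd e" "e dvd k" "d < e"
      have sub: "{i \<in> U d. rigid A e (x i)} = {i\<in>V. rigid A e (x i) \<and> \<not> rigid A k (x i)}"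
        unfolding U_def using rigid_dvd e(2) by blast
      show "int (card {i \<in> U d. rigid A e (x i)}) < k div e"
      proof (cases "e = k")
        case True
        then have "{i \<in> U d. rigid A e (x i)} = {}" unfolding sub by blast
        then show ?thesis using True k'(1) by (simp only: card.empty) simp
      next
        case False
        then have "e < k" using zdvd_imp_le[OF e(3) k'(1)] by simp
        moreover have "\<not> T e" using d_max[of e] e by auto
        ultimately show ?thesis using e d'(2) sub unfolding T_def U_def by (auto intro: dvd_trans)
      qed
    qed blast
    have "Q d"
      unfolding Q_def
    proof (intro conjI exI[of _ "J' \<union> J"] exI[of _ "s' + s"])
      have disj: "J' \<inter> J = {}" using J'(1) J(3) unfolding U_def by blast
      have fin: "finite J'" "finite J" using J'(1) finU J(1) assms(2) finite_subset by blast+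
      show "d dvd n" using d'(3) k'(3) by (rule dvd_trans)
      show "J' \<union> J \<subseteq> V" using J'(1) J(1) unfolding U_def by blast
      show "\<forall>j\<in>J' \<union> J. rigid A d (x j)" using J'(1) J(3) rigid_dvd[OF _ d'(3)] unfolding U_def by blast
      have "int (card J') + int (card J) < n div d"
      proof -
        define p where "p = k div d"
        define q where "q = n div k"
        have pq: "1 \<le> p" "1 \<le> q" using J'(2) J(2) unfolding p_def q_def by linarith+
        have "n = d * (p * q)" using d'(3) k'(3) unfolding p_def q_def by (simp add: mult.assoc[symmetric])
        then have "n div d = p * q" using d'(1) by simp
        \<comment> \<open>This gives \<open>(p - 1) + (q - 1) < p * q\<close>, so the two size
          bounds combine to the bound for \<open>d\<close>.\<close>
        moreover have "0 \<le> (p - 1) * (q - 1)" using pq by simp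
        ultimately have "p + q - 1 \<le> n div d" by (simp add: algebra_simps)
        then show ?thesis using J'(2) J(2) unfolding p_def q_def by linarith
      qed
      then show "int (card (J' \<union> J)) < n div d" using fin disj by (simp add: card_Un_disjoint)
      show "{y. [y = s' + s] (mod d)} \<subseteq> reach A n x (J' \<union> J)"
      proof
        fix y assume "y \<in> {y. [y = s' + s] (mod d)}"
        then have "[y - s = s'] (mod d)" by (simp add: cong_iff_dvd_diff algebra_simps)
        then have "y - s \<in> reach A k x J'" using J'(3) by blast
        \<comment> \<open>\<open>J'\<close> attains the target only modulo \<open>k\<close>. The
          remainder after subtracting its actual sum is congruent to \<open>s\<close> modulo
          \<open>k\<close>, hence attained by \<open>J\<close> modulo \<open>n\<close>.\<close>
        then obtain a where a: "\<forall>j\<in>J'. a j \<in> A" "[(\<Sum>j\<in>J'. a j * x j) = y - s] (mod k)"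
          unfolding reach_def by blast
        let ?w = "\<Sum>j\<in>J'. a j * x j"
        have "?w \<in> reach A n x J'" using a(1) by (intro reachI[where a = a]) auto
        moreover have "[y - ?w = s] (mod k)" using cong_diff[OF cong_refl[of y] a(2)] by simp
        then have "y - ?w \<in> reach A n x J" using J(4) by blast
        ultimately have "?w + (y - ?w) \<in> reach A n x (J' \<union> J)" by (rule reach_Un[OF fin disj])
        then show "y \<in> reach A n x (J' \<union> J)" by simp
      qed
    qed (use d' in auto)
    then show False using k_min[of d] d'(1,4) by simp
  qed
  then show ?thesis using that[OF k' J(1,2,4)] by blast
qed

section \<open>Weighted zero-sums of prescribed length\<close>


text \<open>Pigeonhole on the \<open>card F + 1\<close> partial sums with one constant weight: two
  of them agree modulo \<open>h\<close>.\<close>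

lemma zero_sum_cong:
  fixes y :: "'i \<Rightarrow> int"
  assumes "finite F" "A \<noteq> {}" "0 < h" "h \<le> int (card F)"
  obtains J where "J \<subseteq> F" "J \<noteq> {}" "0 \<in> reach A h y J"
proof -
  obtain a where a: "a \<in> A" using assms(2) by blast
  obtain f where f: "bij_betw f {0..<card F} F" using ex_bij_betw_nat_finite[OF assms(1)] by blast
  define P where "P k = (\<Sum>i<k. a * y (f i)) mod h" for k
  have "\<not> inj_on P {..card F}"
  proof
    assume inj: "inj_on P {..card F}"
    have "P ` {..card F} \<subseteq> {0..<h}" unfolding P_def using assms(3) by auto
    from card_inj_on_le[OF inj this] show False using assms(4) by simp
  qed
  then obtain k l where kl: "k < l" "l \<le> card F" "P k = P l"
    unfolding inj_on_def by (metis atMost_iff linorder_neqE_nat)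
  let ?J = "f ` {k..<l}"
  have sub: "{k..<l} \<subseteq> {0..<card F}" using kl(2) by auto
  have "(\<Sum>j\<in>?J. a * y j) = (\<Sum>i\<in>{k..<l}. a * y (f i))"
    using sum.reindex[OF inj_on_subset[OF bij_betw_imp_inj_on[OF f] sub], of "\<lambda>j. a * y j"] by (simp add: comp_def)
  also have "\<dots> = (\<Sum>i<l. a * y (f i)) - (\<Sum>i<k. a * y (f i))"
    using kl(1) sum_diff[of "{..<l}" "{..<k}" "\<lambda>i. a * y (f i)"]
    by (simp add: lessThan_atLeast0 sum_diff_nat_ivl)
  also have "[\<dots> = 0] (mod h)"
    using kl(3) unfolding P_def by (simp add: cong_iff_dvd_diff mod_eq_dvd_iff dvd_diff_commute)
  finally have "0 \<in> reach A h y ?J" using a by (intro reachI[where a = "\<lambda>_. a"]) auto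
  moreover have "?J \<subseteq> F" using bij_betw_imp_surj_on[OF f] sub by blast
  moreover have "?J \<noteq> {}" using kl(1) by simp
  ultimately show ?thesis using that by blast
qed

text \<open>Condenses the family of divisibilities that defines rigidity into a single one.\<close>

lemma dvd_mult_Gcd_iff:
  fixes D :: "int set"
  shows "h dvd Gcd D * x \<longleftrightarrow> (\<forall>d\<in>D. h dvd d * x)"
proof
  assume "\<forall>d\<in>D. h dvd d * x"
  then have "h dvd Gcd ((*) x ` D)" by (intro Gcd_greatest) (auto simp: mult.commute)
  moreover have "Gcd ((*) x ` D) = normalize (x * Gcd D)" by (rule Gcd_mult)
  ultimately show "h dvd Gcd D * x" by (simp only: dvd_normalize_iff mult.commute[of x])
next
  assume *: "h dvd Gcd D * x"
  show "\<forall>d\<in>D. h dvd d * x"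
  proof
    fix d assume "d \<in> D"
    then have "Gcd D * x dvd d * x" by simp
    then show "h dvd d * x" using * dvd_trans by blast
  qed
qed

text \<open>The Davenport property \<open>dav\<close> is required for every sequence
  \<open>y\<close>, because it is applied to a translate of \<open>x\<close>.\<close>

lemma zero_sum_of_length:
  fixes x :: "'i \<Rightarrow> int" and n :: int
  assumes "0 < n" "A \<noteq> {}" "finite I"
    and dav: "\<And>F (y :: 'i \<Rightarrow> int). F \<subseteq> I \<Longrightarrow> D \<le> card F \<Longrightarrow> \<exists>J\<subseteq>F. J \<noteq> {} \<and> 0 \<in> reach A n y J"
    and len: "int D + n - 1 \<le> int (card I)"
  obtains K where "K \<subseteq> I" "int (card K) = n" "0 \<in> reach A n x K"
proof -
  obtain a0 where a0: "a0 \<in> A" using assms(2) by blast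
  \<comment> \<open>Differences from the fixed weight \<open>a0\<close> generate all differences.
    Including \<open>n\<close> keeps \<open>g\<close> positive even when all weights
    coincide.\<close>
  define g where "g = Gcd (insert n ((\<lambda>a. a - a0) ` A))"
  have gn: "g dvd n" unfolding g_def by (rule Gcd_dvd) simp
  have g: "0 < g" using assms(1) gn unfolding g_def
    by (metis Gcd_int_greater_eq_0 dvd_0_left_iff less_le less_irrefl)
  have rigid_iff: "rigid A h z \<longleftrightarrow> h dvd g * z" if "h dvd n" for h z
  proof -
    have "h dvd g * z \<longleftrightarrow> (\<forall>a\<in>A. h dvd (a - a0) * z)"
      unfolding g_def dvd_mult_Gcd_iff using that by auto
    also have "\<dots> \<longleftrightarrow> (\<forall>a\<in>A. [a * z = a0 * z] (mod h))"
      by (simp add: cong_iff_dvd_diff algebra_simps)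
    also have "\<dots> \<longleftrightarrow> rigid A h z"
      unfolding rigid_def using a0 by (blast intro: cong_trans cong_sym)
    finally show ?thesis by simp
  qed

  define bad where "bad h = {i\<in>I. \<not> rigid A h (x i)}" for h
  \<comment> \<open>The bound is 0 at \<open>h = g\<close>, where every term is rigid, so
    \<open>g\<close> itself is admissible.\<close>
  define adm where "adm h \<longleftrightarrow> 0 < h \<and> g dvd h \<and> h dvd n \<and> int (card (bad h)) \<le> h - g" for h
  have "bad g = {}" unfolding bad_def using rigid_iff[OF gn] by simp
  then have "adm g" unfolding adm_def using g gn by simp
  moreover have "\<forall>h. adm h \<longrightarrow> nat h < nat (n + 1)"
    unfolding adm_def using assms(1) by (auto dest: zdvd_imp_le)
  ultimately obtain h where "adm h" and h_max: "\<And>k. adm k \<Longrightarrow> nat k \<le> nat h"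
    using ex_has_greatest_nat[of adm g nat "nat (n + 1)"] by blast
  then have h: "0 < h" "g dvd h" "h dvd n" "int (card (bad h)) \<le> h - g" unfolding adm_def by auto
  \<comment> \<open>The numbers rigid modulo \<open>h\<close> are the multiples of \<open>q\<close>;
    dividing by \<open>q\<close> identifies their classes with Z/g.\<close>
  define q where "q = h div g"
  have q: "h = g * q" "0 < q" unfolding q_def using h(1,2) g by (auto simp: pos_imp_zdiv_pos_iff zdvd_imp_le)

  have "\<forall>c. h dvd g * c \<longrightarrow> card {i\<in>I. h dvd x i - c} < card I + 1"
    using assms(3) by (auto intro!: le_imp_less_Suc card_mono)
  then obtain c where c: "h dvd g * c"
    and c_max: "\<And>c'. h dvd g * c' \<Longrightarrow> card {i\<in>I. h dvd x i - c'} \<le> card {i\<in>I. h dvd x i - c}"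
    using ex_has_greatest_nat[of "\<lambda>c. h dvd g * c" 0 "\<lambda>c. card {i\<in>I. h dvd x i - c}" "card I + 1"] by auto
  define y where "y i = x i - c" for i
  define Z where "Z = {i\<in>I. h dvd y i}"
  have rigid_c: "rigid A h c" using rigid_iff[OF h(3)] c by simp
  have rigid_y: "rigid A h (y i) \<longleftrightarrow> rigid A h (x i)" for i
    unfolding rigid_iff[OF h(3)] y_def right_diff_distrib
    using dvd_add_left_iff[OF c, of "g * x i - g * c"] by simp
  have fin: "finite K" if "K \<subseteq> I" for K using that assms(3) finite_subset by blast

  define zs where "zs M \<longleftrightarrow> Z \<subseteq> M \<and> M \<subseteq> I \<and> 0 \<in> reach A h y M" for M
  have "zs Z"
  proof -
    have "h dvd (\<Sum>j\<in>Z. a0 * y j)" unfolding Z_def by (intro dvd_sum) auto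
    then have "0 \<in> reach A h y Z"
      using a0 by (intro reachI[where a = "\<lambda>_. a0"]) (auto simp: cong_0_iff)
    then show ?thesis unfolding zs_def Z_def by blast
  qed
  moreover have "\<forall>M. zs M \<longrightarrow> card M < card I + 1"
    unfolding zs_def using assms(3) by (auto intro!: le_imp_less_Suc card_mono)
  ultimately obtain M where M: "zs M" and M_max: "\<And>M'. zs M' \<Longrightarrow> card M' \<le> card M"
    using ex_has_greatest_nat[of zs Z card "card I + 1"] by blast
  have MI: "M \<subseteq> I" "Z \<subseteq> M" using M unfolding zs_def by auto
  \<comment> \<open>A nonempty zero-sum outside \<open>M\<close> could be joined to
    \<open>M\<close>, against maximality.\<close>
  have free: "J = {}" if "J \<subseteq> I - M" "0 \<in> reach A h y J" for J
  proof (rule ccontr)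
    assume "J \<noteq> {}"
    have "0 + 0 \<in> reach A h y (M \<union> J)"
      using that M MI unfolding zs_def by (intro reach_Un fin) auto
    then have "zs (M \<union> J)" using that(1) M unfolding zs_def by auto
    moreover have "card (M \<union> J) = card M + card J"
      using that(1) MI by (intro card_Un_disjoint fin) auto
    moreover have "0 < card J" using \<open>J \<noteq> {}\<close> that(1) fin[of J] by (auto simp: card_gt_0_iff)
    ultimately show False using M_max[of "M \<union> J"] by simp
  qed
  \<comment> \<open>A zero-sum modulo \<open>n\<close> is also one modulo \<open>h\<close>, so
    \<open>dav\<close> would contradict \<open>free\<close>.\<close>
  have "card (I - M) < D"
  proof (rule ccontr)
    assume "\<not> card (I - M) < D"
    then obtain J where "J \<subseteq> I - M" "J \<noteq> {}" "0 \<in> reach A n y J" using dav[of "I - M" y] by auto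
    then show False using free[of J] reach_dvd[OF h(3)] by blast
  qed
  moreover have "card I = card M + card (I - M)"
    using card_Un_disjoint[of M "I - M"] MI fin by (simp add: Un_absorb1)
  ultimately have M_ge: "n \<le> int (card M)" using len by linarith
  have F_less: "int (card (I - M)) < h"
  proof (rule ccontr)
    assume "\<not> int (card (I - M)) < h"
    then obtain J where "J \<subseteq> I - M" "J \<noteq> {}" "0 \<in> reach A h y J"
      using zero_sum_cong[of "I - M" A h y] assms(2) h(1) fin by auto
    then show False using free by blast
  qed

  define V where "V = M - bad h"
  have V: "V \<subseteq> M" "\<And>i. i \<in> V \<Longrightarrow> rigid A h (x i)" unfolding V_def bad_def using MI by auto
  have "finite V" using V(1) MI fin by blast
  obtain k J s where k: "0 < k" "h dvd k" "k dvd n" and J: "J \<subseteq> V" "int (card J) < n div k"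
    "{y. [y = s] (mod k)} \<subseteq> reach A n x J"
    and few: "int (card {i\<in>V. \<not> rigid A k (x i)}) < k div h"
    using rigid_core[where h = h and x = x, OF assms(2) \<open>finite V\<close> assms(1) h(1,3) V(2)] by blast
  \<comment> \<open>Otherwise \<open>k = t * h\<close> with \<open>t \<ge> 2\<close>, and
    \<open>bad k\<close> has at most \<open>(h - g) + (h - 1) + (t - 1)\<close> elements. This is at
    most \<open>k - g\<close> because \<open>(t - 2) * (h - 1)\<close> is nonnegative, so
    \<open>k\<close> would be a larger admissible modulus.\<close>
  have "k = h"
  proof (rule ccontr)
    assume "k \<noteq> h"
    define t where "t = k div h"
    have kt: "k = t * h" unfolding t_def using k(2) by simp
    have "t \<noteq> 1" "0 < t" using kt \<open>k \<noteq> h\<close> k(1) h(1) by (auto simp: zero_less_mult_iff)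
    then have t: "2 \<le> t" by simp
    have "bad k \<subseteq> bad h \<union> (I - M) \<union> {i\<in>V. \<not> rigid A k (x i)}"
      using bad_def V_def by auto
    then have "card (bad k) \<le> card (bad h \<union> (I - M) \<union> {i\<in>V. \<not> rigid A k (x i)})"
      using \<open>finite V\<close> assms(3) by (intro card_mono) (auto simp: bad_def)
    also have "\<dots> \<le> card (bad h) + card (I - M) + card {i\<in>V. \<not> rigid A k (x i)}"
      by (meson add_le_mono1 card_Un_le order_trans)
    finally have "int (card (bad k)) \<le> (h - g) + (h - 1) + (t - 1)"
      using h(4) F_less few unfolding t_def by linarith
    moreover have "0 \<le> (t - 2) * (h - 1)" using t h(1) by simp
    ultimately have "int (card (bad k)) \<le> k - g" unfolding kt by (simp add: algebra_simps)
    then have "adm k" unfolding adm_def using k h(2) dvd_trans by blast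
    then show False using h_max[of k] \<open>k \<noteq> h\<close> zdvd_imp_le[OF k(2,1)] k(1) by simp
  qed
  note J = J[unfolded \<open>k = h\<close>]

  \<comment> \<open>Shrink \<open>M\<close> around \<open>J\<close> until the excess over \<open>n\<close> can be removed from \<open>Z\<close>, whose terms
    vanish modulo \<open>h\<close> after the translation.\<close>
  define ok where "ok M' \<longleftrightarrow> J \<union> Z \<subseteq> M' \<and> M' \<subseteq> M \<and> 0 \<in> reach A h y M' \<and> n \<le> int (card M')" for M'
  have "ok M" unfolding ok_def using M M_ge J(1) V(1) unfolding zs_def by blast
  then obtain M1 where M1: "ok M1" and M1_min: "\<And>M'. ok M' \<Longrightarrow> card M1 \<le> card M'"
    using ex_has_least_nat[of ok M card] by blast
  define w where "w = card (Z - J)"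
  have JZ: "J \<subseteq> I" "Z \<subseteq> I" using J(1) V(1) MI by auto
  \<comment> \<open>If \<open>M1\<close> were larger, a zero-sum \<open>R\<close> of at most
    \<open>w\<close> rigid terms outside \<open>J \<union> Z\<close> could be deleted, leaving at
    least \<open>n\<close> terms and contradicting minimality.\<close>
  have excess: "int (card M1) \<le> n + int w"
  proof (rule ccontr)
    assume big: "\<not> int (card M1) \<le> n + int w"
    define W where "W = M1 - bad h - (J \<union> Z)"
    have WI: "W \<subseteq> M1" "M1 \<subseteq> I" using M1 MI unfolding W_def ok_def by auto
    define v where "v i = y i div q" for i
    have qv: "y i = q * v i" and yg: "rigid A h (y i)" if "i \<in> W" for i
    proof -
      show r: "rigid A h (y i)" using that WI rigid_y unfolding W_def bad_def by blast
      then have "g * q dvd g * y i" using rigid_iff[OF h(3)] q(1) by simp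
      then show "y i = q * v i" unfolding v_def using g by simp
    qed
    have nz: "\<not> g dvd v i" if "i \<in> W" for i
    proof
      assume "g dvd v i"
      then have "h dvd y i" unfolding q(1) qv[OF that] by (simp add: mult.commute mult_dvd_mono)
      then show False using that WI unfolding W_def Z_def by blast
    qed
    define \<tau> where "\<tau> u = card {i\<in>W. v i mod g = u}" for u
    define b where "b = card (J \<inter> Z)"
    have zb: "card Z = w + b"
      using card_Diff_subset_Int[of Z J] card_mono[of Z "Z \<inter> J"] fin[OF JZ(2)] unfolding w_def b_def
      by (simp add: Int_commute)
    \<comment> \<open>Before translation these terms lie in the rigid class of
      \<open>c + q * u\<close>, which is at most as frequent as that of \<open>c\<close>.\<close>
    have "\<tau> u \<le> card Z" for u
    proof -
      have "{i\<in>W. v i mod g = u} \<subseteq> {i\<in>I. h dvd x i - (c + q * u)}"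
      proof safe
        fix i assume i: "i \<in> W"
        then show "i \<in> I" using WI by blast
        have "x i - (c + q * (v i mod g)) = q * (v i - v i mod g)"
          using qv[OF i] unfolding y_def by (simp add: algebra_simps)
        also have "\<dots> = h * (v i div g)" unfolding q(1) by (simp add: minus_mod_eq_mult_div)
        finally show "h dvd x i - (c + q * (v i mod g))" by simp
      qed
      then have "\<tau> u \<le> card {i\<in>I. h dvd x i - (c + q * u)}"
        unfolding \<tau>_def using assms(3) by (intro card_mono) auto
      also have "\<dots> \<le> card Z"
        using c_max[of "c + q * u"] c unfolding Z_def y_def q(1) by (simp add: distrib_left)
      finally show ?thesis .
    qed
    then have \<tau>_le: "\<tau> u \<le> min w (\<tau> u) + b" for u using zb by (simp add: min_def)
    have "card W = (\<Sum>u\<in>{1..<g}. \<tau> u)"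
    proof -
      have "v i mod g \<in> {1..<g}" if "i \<in> W" for i
        using nz[OF that] pos_mod_bound[OF g, of "v i"] pos_mod_sign[OF g, of "v i"]
        by (auto simp: dvd_eq_mod_eq_0)
      then have "W = (\<Union>u\<in>{1..<g}. {i\<in>W. v i mod g = u})" by auto
      moreover have "finite W" using WI fin by blast
      ultimately show ?thesis
        using card_UN_disjoint[of "{1..<g}" "\<lambda>u. {i\<in>W. v i mod g = u}"] unfolding \<tau>_def by auto
    qed
    also have "\<dots> \<le> (\<Sum>u\<in>{1..<g}. min w (\<tau> u)) + nat (g - 1) * b"
      using sum_mono[of "{1..<g}" \<tau> "\<lambda>u. min w (\<tau> u) + b"] \<tau>_le by (simp add: sum.distrib)
    finally have cW: "card W \<le> (\<Sum>u\<in>{1..<g}. min w (\<tau> u)) + nat (g - 1) * b" .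
    have "int (card W) \<le> int (\<Sum>u\<in>{1..<g}. min w (\<tau> u)) + (g - 1) * int b"
    proof -
      have "int (card W) \<le> int ((\<Sum>u\<in>{1..<g}. min w (\<tau> u)) + nat (g - 1) * b)" using cW by (simp only: of_nat_le_iff)
      then show ?thesis using g by simp
    qed
    moreover have "int (card M1) \<le> (h - g) + int (card (J - Z)) + int (card Z) + int (card W)"
    proof -
      have "M1 \<subseteq> bad h \<union> (J - Z) \<union> Z \<union> W" unfolding W_def by blast
      then have "card M1 \<le> card (bad h \<union> (J - Z) \<union> Z \<union> W)"
        using fin JZ WI by (intro card_mono fin) (auto simp: bad_def)
      also have "\<dots> \<le> card (bad h) + card (J - Z) + card Z + card W"
        by (meson add_le_mono1 card_Un_le order_trans)
      finally show ?thesis using h(4) by linarith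
    qed
    \<comment> \<open>A term of \<open>J \<inter> Z\<close> is charged \<open>g\<close> times: once
      in \<open>Z\<close> and once for each of the \<open>g - 1\<close> nonzero classes, where
      truncating at \<open>w\<close> instead of \<open>card Z\<close> may lose it.\<close>
    moreover have "int (card (J - Z)) + g * int b \<le> g * (n div h - 1)"
    proof -
      have "card J = card (J - Z) + b"
        using card_Diff_subset_Int[of J Z] card_mono[of J "J \<inter> Z"] fin[OF JZ(1)] unfolding b_def by simp
      then have "int (card (J - Z)) + int b \<le> n div h - 1" using J(2) by simp
      then have "g * (int (card (J - Z)) + int b) \<le> g * (n div h - 1)" using g by simp
      moreover have "int (card (J - Z)) \<le> g * int (card (J - Z))"
        using g mult_right_mono[of 1 g "int (card (J - Z))"] by simp
      ultimately show ?thesis by (simp add: distrib_left)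
    qed
    moreover have "g * (n div h - 1) + (h - g) \<le> n - g"
    proof -
      have nh: "n = h * (n div h)" using h(3) by simp
      have "0 < n div h" using assms(1) h(1,3) by (simp add: pos_imp_zdiv_pos_iff zdvd_imp_le)
      then have "0 \<le> (h - g) * (n div h - 1)" using zdvd_imp_le[OF h(2,1)] by simp
      then show ?thesis using nh by (simp add: algebra_simps)
    qed
    ultimately have "g \<le> int (\<Sum>u\<in>{1..<g}. min w (\<tau> u))" using big zb by (simp add: algebra_simps)
    then obtain R where R: "R \<subseteq> W" "R \<noteq> {}" "card R \<le> w" "g dvd (\<Sum>i\<in>R. v i)"
      using short_zero_sum[where v = v and W = W and k = w, OF g _ nz] fin WI unfolding \<tau>_def by blast
    have finM1: "finite M1" "finite R" using WI R(1) fin by blast+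
    obtain a where a: "\<forall>j\<in>M1. a j \<in> A" "[(\<Sum>j\<in>M1. a j * y j) = 0] (mod h)"
      using M1 unfolding ok_def reach_def by blast
    have RM: "R \<subseteq> M1" using R(1) WI by blast
    \<comment> \<open>Rigidity allows replacing all weights on \<open>R\<close> by
      \<open>a0\<close>, after which the sum is a multiple of \<open>q * g = h\<close>.\<close>
    have "[(\<Sum>j\<in>R. a j * y j) = (\<Sum>j\<in>R. a0 * y j)] (mod h)"
      using a(1) a0 yg R(1) RM unfolding rigid_def by (intro cong_sum) blast
    also have "(\<Sum>j\<in>R. a0 * y j) = a0 * (q * (\<Sum>j\<in>R. v j))"
      using qv R(1) by (auto simp: sum_distrib_left intro!: sum.cong)
    also have "[\<dots> = 0] (mod h)" using R(4) unfolding q(1) cong_0_iff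
      by (simp add: mult.commute mult_dvd_mono dvd_mult)
    finally have "[(\<Sum>j\<in>M1 - R. a j * y j) = 0] (mod h)"
      using a(2) cong_diff[OF a(2)] sum_diff[OF finM1(1) RM, of "\<lambda>j. a j * y j"] by fastforce
    then have "0 \<in> reach A h y (M1 - R)" using a(1) by (intro reachI[where a = a]) auto
    moreover have cR: "card (M1 - R) = card M1 - card R" using RM finM1(2) by (rule card_Diff_subset[rotated])
    moreover have "J \<union> Z \<subseteq> M1 - R" using M1 R(1) unfolding ok_def W_def by blast
    ultimately have "ok (M1 - R)" using M1 big R(3) unfolding ok_def by auto
    then have "card M1 \<le> card (M1 - R)" by (rule M1_min)
    moreover have "0 < card R" "card R \<le> card M1"
      using R(2) finM1 RM by (auto simp: card_gt_0_iff card_mono)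
    ultimately show False using cR by linarith
  qed

  have M1': "J \<union> Z \<subseteq> M1" "M1 \<subseteq> I" "0 \<in> reach A h y M1" "n \<le> int (card M1)"
    using M1 MI unfolding ok_def by auto
  obtain E where E: "E \<subseteq> Z - J" "int (card E) = int (card M1) - n"
  proof -
    have "nat (int (card M1) - n) \<le> card (Z - J)" using excess unfolding w_def by simp
    then obtain E where "E \<subseteq> Z - J" "card E = nat (int (card M1) - n)"
      by (metis obtain_subset_with_card_n)
    then show ?thesis using that M1'(4) by simp
  qed
  define K where "K = M1 - E"
  have EM: "E \<subseteq> M1" "finite E" using E(1) M1'(1,2) fin by blast+
  have KI: "K \<subseteq> I" "finite K" "J \<subseteq> K" "finite J"
    using M1'(1,2) E(1) fin JZ(1) unfolding K_def by auto
  have cK: "int (card K) = n"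
    unfolding K_def using card_Diff_subset[OF EM(2,1)] card_mono[OF fin[OF M1'(2)] EM(1)] E(2) by simp
  obtain a where a: "\<forall>j\<in>M1. a j \<in> A" "[(\<Sum>j\<in>M1. a j * y j) = 0] (mod h)"
    using M1'(3) unfolding reach_def by blast
  have "h dvd (\<Sum>j\<in>E. a j * y j)" using E(1) unfolding Z_def by (intro dvd_sum) auto
  then have "[(\<Sum>j\<in>K. a j * y j) = 0] (mod h)"
    using a(2) sum_diff[OF fin[OF M1'(2)] EM(1), of "\<lambda>j. a j * y j"] unfolding K_def cong_0_iff by simp
  moreover have "[(\<Sum>j\<in>K. a j * c) = 0] (mod h)"
  proof -
    \<comment> \<open>As \<open>c\<close> is rigid, the weights may be made equal; the
      \<open>n\<close> copies then vanish modulo \<open>h\<close> since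
      \<open>h dvd n\<close>.\<close>
    have "[(\<Sum>j\<in>K. a j * c) = (\<Sum>j\<in>K. a0 * c)] (mod h)"
      using a(1) a0 rigid_c unfolding rigid_def K_def by (intro cong_sum) blast
    also have "(\<Sum>j\<in>K. a0 * c) = n * (a0 * c)" using cK by simp
    also have "[\<dots> = 0] (mod h)"
    proof -
      have "h dvd n * (a0 * c)" using h(3) by simp
      then show ?thesis by (simp add: cong_0_iff)
    qed
    finally show ?thesis .
  qed
  ultimately have "[(\<Sum>j\<in>K. a j * y j) + (\<Sum>j\<in>K. a j * c) = 0 + 0] (mod h)" by (rule cong_add)
  then have total: "[(\<Sum>j\<in>K. a j * x j) = 0] (mod h)"
    unfolding y_def by (simp add: sum.distrib[symmetric] right_diff_distrib)
  define r where "r = (\<Sum>j\<in>K - J. a j * x j)"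
  have split: "(\<Sum>j\<in>K. a j * x j) = r + (\<Sum>j\<in>J. a j * x j)"
    unfolding r_def using sum.subset_diff[OF KI(3,2)] by simp
  have r_reach: "r \<in> reach A n x (K - J)"
    using a(1) unfolding r_def K_def by (intro reachI[where a = a]) auto
  have "(\<Sum>j\<in>J. a j * x j) \<in> reach A h x J"
    using a(1) M1'(1) by (intro reachI[where a = a]) auto
  moreover have "s \<in> reach A h x J" using J(3) reach_dvd[OF h(3)] cong_refl by blast
  ultimately have sJ: "[(\<Sum>j\<in>J. a j * x j) = s] (mod h)"
    using rigid_reach_cong[of J A h x] V(2) J(1) by blast
  \<comment> \<open>The current sum over \<open>J\<close> lies in the class of \<open>s\<close>, the
    one that \<open>J\<close> fills modulo \<open>n\<close>. So new weights on \<open>J\<close> can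
    cancel \<open>r\<close> exactly modulo \<open>n\<close>.\<close>
  have "[- r = s] (mod h)"
  proof -
    have "[r + (\<Sum>j\<in>J. a j * x j) - r = 0 - r] (mod h)"
      using total unfolding split by (rule cong_diff[OF _ cong_refl])
    then have "[- r = (\<Sum>j\<in>J. a j * x j)] (mod h)" by (simp add: cong_sym_eq)
    then show ?thesis using sJ by (rule cong_trans)
  qed
  then have "- r \<in> reach A n x J" using J(3) by blast
  then have "r + - r \<in> reach A n x ((K - J) \<union> J)"
    using r_reach KI by (intro reach_Un) auto
  then have "0 \<in> reach A n x K" using KI(3) by (simp add: Un_absorb2)
  then show ?thesis using that KI(1) cK by blast
qed

section \<open>Passage to the two constants, and the lower bound\<close>

lemma weighted_zero_sum_iff_reach: "weighted_zero_sum A n x J \<longleftrightarrow> 0 \<in> reach A (int n) x J"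
  unfolding weighted_zero_sum_def reach_def by simp

text \<open>The least number exists because \<open>n\<close> has the property, by the pigeonhole
  argument.\<close>

lemma weighted_davenport_works:
  assumes "n > 0" "A \<noteq> {}" "zmod_seq n (weighted_davenport A n) x"
  shows "\<exists>J. J \<subseteq> {1..weighted_davenport A n} \<and> J \<noteq> {} \<and> weighted_zero_sum A n x J"
proof -
  have "\<forall>x. zmod_seq n n x \<longrightarrow> (\<exists>J. J \<subseteq> {1..n} \<and> J \<noteq> {} \<and> weighted_zero_sum A n x J)"
  proof (intro allI impI)
    fix x :: "nat \<Rightarrow> int"
    obtain J where "J \<subseteq> {1..n}" "J \<noteq> {}" "0 \<in> reach A (int n) x J"
      using zero_sum_cong[of "{1..n}" A "int n" x] assms(1,2) by auto
    then show "\<exists>J. J \<subseteq> {1..n} \<and> J \<noteq> {} \<and> weighted_zero_sum A n x J"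
      unfolding weighted_zero_sum_iff_reach by blast
  qed
  from LeastI[where P = "\<lambda>k. \<forall>x. zmod_seq n k x \<longrightarrow>
      (\<exists>J. J \<subseteq> {1..k} \<and> J \<noteq> {} \<and> weighted_zero_sum A n x J)", OF this]
  show ?thesis using assms(3) unfolding weighted_davenport_def by blast
qed

text \<open>Frees the Davenport property from initial segments and reduced representatives, as
  needed for complements of subfamilies and translated terms: a subset of exactly the right size is
  enumerated and its values are reduced modulo \<open>n\<close>.\<close>

lemma weighted_davenport_finite_family:
  fixes y :: "'i \<Rightarrow> int"
  assumes "n > 0" "A \<noteq> {}" "finite F" "weighted_davenport A n \<le> card F"
  shows "\<exists>J\<subseteq>F. J \<noteq> {} \<and> 0 \<in> reach A (int n) y J"
proof -
  let ?D = "weighted_davenport A n"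
  obtain F' where F': "F' \<subseteq> F" "card F' = ?D" "finite F'"
    using obtain_subset_with_card_n[OF assms(4)] by blast
  obtain f where f: "bij_betw f {1..?D} F'" using ex_bij_betw_nat_finite_1[OF F'(3)] F'(2) by auto
  have "zmod_seq n ?D (\<lambda>i. y (f i) mod int n)" unfolding zmod_seq_def using assms(1) by simp
  then obtain J where J: "J \<subseteq> {1..?D}" "J \<noteq> {}" "weighted_zero_sum A n (\<lambda>i. y (f i) mod int n) J"
    using weighted_davenport_works[OF assms(1,2)] by blast
  obtain a where a: "\<forall>j\<in>J. a j \<in> A" "[(\<Sum>j\<in>J. a j * (y (f j) mod int n)) = 0] (mod int n)"
    using J(3) unfolding weighted_zero_sum_def by blast
  have inj: "inj_on f J" using inj_on_subset[OF bij_betw_imp_inj_on[OF f] J(1)] .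
  define b where "b = a \<circ> inv_into J f"
  have b: "b (f j) = a j" if "j \<in> J" for j unfolding b_def using that inj by simp
  have "(\<Sum>i\<in>f ` J. b i * y i) = (\<Sum>j\<in>J. a j * y (f j))"
    using b by (simp add: sum.reindex[OF inj])
  also have "[\<dots> = (\<Sum>j\<in>J. a j * (y (f j) mod int n))] (mod int n)"
    by (intro cong_sum cong_scalar_left) (simp add: cong_def)
  finally have "0 \<in> reach A (int n) y (f ` J)"
    using a b by (intro reachI[where a = b]) (auto intro: cong_trans)
  moreover have "f ` J \<subseteq> F" using bij_betw_imp_surj_on[OF f] J(1) F'(1) by blast
  ultimately show ?thesis using J(2) by blast
qed

lemma weighted_egz_lower:
  assumes "n > 0" "A \<noteq> {}"
    and egz: "\<And>x. zmod_seq n t x \<Longrightarrow> \<exists>J. J \<subseteq> {1..t} \<and> card J = n \<and> weighted_zero_sum A n x J"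
  shows "weighted_davenport A n + n - 1 \<le> t"
proof (rule ccontr)
  let ?D = "weighted_davenport A n"
  assume t: "\<not> ?D + n - 1 \<le> t"
  have "zmod_seq n ?D (\<lambda>_. 0)" unfolding zmod_seq_def using assms(1) by simp
  \<comment> \<open>Length 0 admits no nonempty \<open>J\<close>. Hence \<open>?D - 1\<close> is a
    smaller length, and minimality supplies a sequence without weighted zero-sums.\<close>
  then have "?D \<noteq> 0" using weighted_davenport_works[OF assms(1,2)] by fastforce
  then have "?D - 1 < ?D" by simp
  from not_less_Least[OF this[unfolded weighted_davenport_def], folded weighted_davenport_def]
  obtain x where x: "zmod_seq n (?D - 1) x"
    and free: "\<And>J. J \<subseteq> {1..?D - 1} \<Longrightarrow> J \<noteq> {} \<Longrightarrow> \<not> weighted_zero_sum A n x J" by blast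
  define x' where "x' i = (if i \<le> ?D - 1 then x i else 0)" for i
  have "zmod_seq n t x'" using x assms(1) unfolding zmod_seq_def x'_def by auto
  then obtain J where J: "J \<subseteq> {1..t}" "card J = n" "weighted_zero_sum A n x' J" using egz by blast
  obtain a where a: "\<forall>j\<in>J. a j \<in> A" "[(\<Sum>j\<in>J. a j * x' j) = 0] (mod int n)"
    using J(3) unfolding weighted_zero_sum_def by blast
  let ?J = "J \<inter> {1..?D - 1}"
  \<comment> \<open>The appended zeros occupy the positions from \<open>?D\<close> to
    \<open>t\<close>, fewer than \<open>n\<close> of them, so \<open>J\<close> cannot consist of
    zeros only.\<close>
  have "?J \<noteq> {}"
  proof
    assume "?J = {}"
    then have "J \<subseteq> {?D..t}" using J(1) by force
    from card_mono[OF _ this] show False using J(2) t \<open>?D \<noteq> 0\<close> assms(1) by simp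
  qed
  moreover have "(\<Sum>j\<in>?J. a j * x j) = (\<Sum>j\<in>J. a j * x' j)"
    using J(1) finite_subset[OF J(1)]
    by (intro sum.mono_neutral_cong_left) (auto simp: x'_def)
  then have "weighted_zero_sum A n x ?J"
    using a unfolding weighted_zero_sum_def by (intro exI[of _ a]) auto
  ultimately show False using free[of ?J] by blast
qed

theorem theorem1p2:
  fixes n :: nat and A :: "int set"
  assumes "n > 0" and "A \<noteq> {}"
  shows "weighted_egz A n = weighted_davenport A n + n - 1"
  unfolding weighted_egz_def
proof (rule Least_equality)
  let ?t = "weighted_davenport A n + n - 1"
  show "\<forall>x. zmod_seq n ?t x \<longrightarrow> (\<exists>J. J \<subseteq> {1..?t} \<and> card J = n \<and> weighted_zero_sum A n x J)"
  proof (intro allI impI)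
    fix x :: "nat \<Rightarrow> int"
    have dav: "\<exists>J\<subseteq>F. J \<noteq> {} \<and> 0 \<in> reach A (int n) y J"
      if "F \<subseteq> {1..?t}" "weighted_davenport A n \<le> card F" for F and y :: "nat \<Rightarrow> int"
      using weighted_davenport_finite_family[OF assms _ that(2)] finite_subset[OF that(1)] by blast
    have pos: "0 < int n" using assms(1) by simp
    have len: "int (weighted_davenport A n) + int n - 1 \<le> int (card {1..?t})" using assms(1) by simp
    obtain K where "K \<subseteq> {1..?t}" "int (card K) = int n" "0 \<in> reach A (int n) x K"
      by (rule zero_sum_of_length[OF pos assms(2) finite_atLeastAtMost _ len, of x])
        (erule (1) dav, erule (2) that)
    then show "\<exists>J. J \<subseteq> {1..?t} \<and> card J = n \<and> weighted_zero_sum A n x J"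
      unfolding weighted_zero_sum_iff_reach by auto
  qed
next
  fix t
  assume "\<forall>x. zmod_seq n t x \<longrightarrow> (\<exists>J. J \<subseteq> {1..t} \<and> card J = n \<and> weighted_zero_sum A n x J)"
  then show "weighted_davenport A n + n - 1 \<le> t" by (intro weighted_egz_lower[OF assms]) blast
qed

end
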